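(* Let $\alpha'=\beta=\beta'=0$ and let $\alpha,\gamma,\gamma'\ge0$ be real numbers, not all zero. Let $X_n$ be the random variables associated with these parameters (see context). If $\gamma'>0$ and (i) $\alpha>0$, then $$\frac{X_n-(\gamma'/\alpha)\log n}{\sqrt{(\gamma'/\alpha)\log n}}\xrightarrow{d}\mathrm{N}(0,1)\quad\text{as } n\to\infty;$$ (ii) $\alpha=0$, then $$X_n\stackrel{d}{=}\mathrm{Bin}\left(n,\frac{\gamma'}{\gamma+\gamma'}\right).$$ If $\gamma'=0$, then $X_n$ is a degenerate random variable equal to $0$.
   Context: For real parameters $\alpha,\beta,\gamma,\alpha',\beta',\gamma'$, the numbers $\left|{n\atop k}\right|$, $0\le k\le n$, are defined by the recurrence $$\left|{n\atop k}\right|=(\alpha n+\beta k+\gamma)\left|{n-1\atop k}\right|+(\alpha' n+\beta' k+\gamma')\left|{n-1\atop k-1}\right|+I_{n=k=0},$$ with $\left|{n\atop k}\right|=0$ unless $0\le k\le n$; thus $\left|{0\atop 0}\right|=1$. The random variable $X_n$ is the integer-valued random variable with $$\mathbb{P}(X_n=k)=\frac{\left|{n\atop k}\right|}{\sum_{j=0}^n\left|{n\atop j}\right|},\qquad 0\le k\le n.$$ $\xrightarrow{d}$ and $\stackrel{d}{=}$ denote convergence and equality in distribution, $\mathrm{N}(0,1)$ is the standard normal distribution, and $\mathrm{Bin}(n,p)$ is the binomial distribution with parameters $n$ and $p$. *)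

theory Defs
  imports "HOL-Probability.Probability"
begin

text \<open>
  The column index is an integer, so that the recurrence for
  \<open>n \<ge> 1\<close> holds for all \<open>k\<close> without case distinction; vanishing outside
  \<open>0 \<le> k \<le> n\<close> is then a consequence (lemma \<open>tri_num_eq_0\<close>). Row \<open>0\<close> is what
  the term \<open>I\<^bsub>n=k=0\<^esub>\<close> contributes. The arguments
  \<open>a b c\<close> and \<open>a' b' c'\<close> are \<open>\<alpha> \<beta> \<gamma>\<close> and \<open>\<alpha>' \<beta>' \<gamma>'\<close>.
\<close>

fun tri_num :: "real \<Rightarrow> real \<Rightarrow> real \<Rightarrow> real \<Rightarrow> real \<Rightarrow> real \<Rightarrow> nat \<Rightarrow> int \<Rightarrow> real" where
  "tri_num a b c a' b' c' 0 k = (if k = 0 then 1 else 0)"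
| "tri_num a b c a' b' c' (Suc n) k =
     (a * real (Suc n) + b * of_int k + c) * tri_num a b c a' b' c' n k
   + (a' * real (Suc n) + b' * of_int k + c') * tri_num a b c a' b' c' n (k - 1)"

lemma tri_num_eq_0: "k < 0 \<or> int n < k \<Longrightarrow> tri_num a b c a' b' c' n k = 0"
  by (induction n arbitrary: k) auto

definition is_tri_rv ::
  "real \<Rightarrow> real \<Rightarrow> real \<Rightarrow> real \<Rightarrow> real \<Rightarrow> real \<Rightarrow> nat \<Rightarrow> 'a measure \<Rightarrow> ('a \<Rightarrow> int) \<Rightarrow> bool" where
  "is_tri_rv a b c a' b' c' n M X \<longleftrightarrow>
     prob_space M \<and> X \<in> measurable M (count_space UNIV) \<and>
     (\<forall>k\<in>{0..int n}. measure M {\<omega> \<in> space M. X \<omega> = k} =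
        tri_num a b c a' b' c' n k / (\<Sum>j\<in>{0..int n}. tri_num a b c a' b' c' n j))"

text \<open>
  For \<open>b = a' = b' = 0\<close> and nonnegative \<open>a, c, c'\<close>, not all zero, the rows can be
  normalised, so such random variables exist for every \<open>n\<close>.
\<close>

lemma tri_num_nonneg:
  assumes "a \<ge> 0" "c \<ge> 0" "c' \<ge> 0"
  shows "tri_num a 0 c 0 0 c' n k \<ge> 0"
  using assms by (induction n arbitrary: k) auto

lemma tri_num_sum_pos:
  assumes "a \<ge> 0" "c \<ge> 0" "c' \<ge> 0" "\<not> (a = 0 \<and> c = 0 \<and> c' = 0)"
  shows "(\<Sum>j\<in>{0..int n}. tri_num a 0 c 0 0 c' n j) > 0"
proof -
  have "\<exists>j\<in>{0..int n}. tri_num a 0 c 0 0 c' n j > 0"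
  proof (cases "c' > 0")
    case True
    have "tri_num a 0 c 0 0 c' n (int n) > 0"
      using True by (induction n) (simp_all add: tri_num_eq_0)
    then show ?thesis by force
  next
    case False
    then have ac: "a * real (Suc m) + c > 0" for m
      using assms by (cases "a = 0") (auto intro: add_pos_nonneg)
    have "tri_num a 0 c 0 0 c' n 0 > 0"
      using ac by (induction n) (simp_all add: tri_num_eq_0)
    then show ?thesis by force
  qed
  then show ?thesis
    by (auto intro: sum_pos2 tri_num_nonneg[OF assms(1-3)])
qed

lemma is_tri_rv_exists:
  assumes "a \<ge> 0" "c \<ge> 0" "c' \<ge> 0" "\<not> (a = 0 \<and> c = 0 \<and> c' = 0)"
  shows "\<exists>p :: int pmf. is_tri_rv a 0 c 0 0 c' n (measure_pmf p) (\<lambda>k. k)"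
proof -
  let ?T = "tri_num a 0 c 0 0 c' n"
  let ?S = "\<Sum>j\<in>{0..int n}. ?T j"
  let ?f = "\<lambda>k. ?T k / ?S"
  have S: "?S > 0" by (rule tri_num_sum_pos[OF assms])
  have nn: "?f k \<ge> 0" for k
    using S tri_num_nonneg[OF assms(1-3)] by (simp add: divide_nonneg_pos)
  have "(\<integral>\<^sup>+k. ennreal (?f k) \<partial>count_space UNIV) = (\<Sum>k\<in>{0..int n}. ennreal (?f k))"
    by (rule nn_integral_count_space') (auto simp: tri_num_eq_0)
  also have "\<dots> = ennreal (\<Sum>k\<in>{0..int n}. ?f k)"
    using nn by (simp add: sum_ennreal)
  also have "(\<Sum>k\<in>{0..int n}. ?f k) = 1"
    using S by (simp flip: sum_divide_distrib)
  finally have "pmf (embed_pmf ?f) k = ?f k" for k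
    using nn by (simp add: pmf_embed_pmf)
  then have "is_tri_rv a 0 c 0 0 c' n (measure_pmf (embed_pmf ?f)) (\<lambda>k. k)"
    by (auto simp: is_tri_rv_def prob_space_measure_pmf measure_pmf_single)
  then show ?thesis by blast
qed

end

theory Submission
  imports Defs
begin

text \<open>
  The generating function of row \<open>n\<close> is the product of the factors
  \<open>\<alpha> j + \<gamma> + \<gamma>' z\<close> for \<open>1 \<le> j \<le> n\<close>, so \<open>X\<^sub>n\<close> is distributed as a
  sum of independent Bernoulli variables with parameters \<open>p j = \<gamma>' / (\<alpha> j + \<gamma> + \<gamma>')\<close>.
  For \<open>\<alpha> > 0\<close> we have \<open>\<Sum>p j = (\<gamma>' / \<alpha>) log n + O(1)\<close> and \<open>\<Sum>(p j)\<^sup>2 = O(1)\<close>. By the second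
  estimate the characteristic function of \<open>X\<^sub>n\<close> is, at the relevant scale,
  asymptotically that of a Poisson variable with mean \<open>\<Sum>p j\<close>; by the first one it then
  suffices to expand the exponent to second order, and Levy's continuity theorem applies.
\<close>

section \<open>The law of a row\<close>

text \<open>The coefficients of the recurrence depend on the row only, so each new row multiplies
  the generating function by one linear factor. The general algebra serves both \<open>z = 1\<close>
  over the reals (normaliser) and \<open>z = iexp s\<close> over the complex numbers (characteristic
  function).\<close>

lemma sum_tri_num_power:
  fixes z :: "'a :: {real_algebra_1, comm_ring_1}"
  shows "(\<Sum>k\<le>n. of_real (tri_num a 0 c 0 0 c' n (int k)) * z ^ k)
    = (\<Prod>j=1..n. of_real (a * real j + c) + of_real c' * z)"
proof (induction n)
  case (Suc n)
  let ?T = "\<lambda>k. of_real (tri_num a 0 c 0 0 c' n k) :: 'a"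
  let ?A = "of_real (a * real (Suc n) + c) :: 'a"
  have "(\<Sum>k\<le>Suc n. of_real (tri_num a 0 c 0 0 c' (Suc n) (int k)) * z ^ k)
    = ?A * (\<Sum>k\<le>Suc n. ?T (int k) * z ^ k)
      + of_real c' * (\<Sum>k\<le>Suc n. ?T (int k - 1) * z ^ k)"
    unfolding sum_distrib_left sum.distrib[symmetric]
    by (intro sum.cong refl) (simp add: algebra_simps)
  \<comment> \<open>Row \<open>n\<close> vanishes at \<open>Suc n\<close>, and at \<open>-1\<close>
    in the shifted sum that follows, so both boundary terms drop.\<close>
  also have "(\<Sum>k\<le>Suc n. ?T (int k) * z ^ k) = (\<Sum>k\<le>n. ?T (int k) * z ^ k)"
    by (simp add: tri_num_eq_0)
  also have "(\<Sum>k\<le>Suc n. ?T (int k - 1) * z ^ k) = z * (\<Sum>k\<le>n. ?T (int k) * z ^ k)"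
    unfolding sum.atMost_Suc_shift sum_distrib_left
    by (simp add: tri_num_eq_0 mult_ac)
  also have "?A * (\<Sum>k\<le>n. ?T (int k) * z ^ k) + of_real c' * (z * (\<Sum>k\<le>n. ?T (int k) * z ^ k))
    = (?A + of_real c' * z) * (\<Sum>k\<le>n. ?T (int k) * z ^ k)"
    by (simp only: distrib_right mult.assoc)
  finally show ?case
    using prod.nat_ivl_Suc'[of 1 n "\<lambda>j. of_real (a * real j + c) + of_real c' * z"]
    by (simp only: Suc.IH)
qed simp

section \<open>Normaliser, law and expectations\<close>

lemma sum_int_atLeast0AtMost: "(\<Sum>k\<in>{0..int n}. f k) = (\<Sum>k\<le>n. f (int k))"
proof -
  have "{0..int n} = int ` {..n}"
    using image_int_atLeastAtMost[of 0 n] by (simp add: atMost_atLeast0)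
  then show ?thesis
    by (simp add: sum.reindex)
qed

lemma sum_tri_num:
  "(\<Sum>k\<in>{0..int n}. tri_num a 0 c 0 0 c' n k) = (\<Prod>j=1..n. a * real j + c + c')"
  using sum_tri_num_power[where z = "1::real", of a c c' n] by (simp add: sum_int_atLeast0AtMost)

text \<open>\<open>is_tri_rv\<close> prescribes the masses on \<open>{0..int n}\<close> only. With a
  nonzero normaliser they already sum to 1 there, so no mass is left for other \<open>k\<close>,
  where \<open>tri_num\<close> vanishes too.\<close>

lemma is_tri_rv_prob:
  assumes "is_tri_rv a b c a' b' c' n M X"
    and S: "(\<Sum>j\<in>{0..int n}. tri_num a b c a' b' c' n j) \<noteq> 0"
  shows "measure M {\<omega> \<in> space M. X \<omega> = k} =
    tri_num a b c a' b' c' n k / (\<Sum>j\<in>{0..int n}. tri_num a b c a' b' c' n j)"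
proof (cases "k \<in> {0..int n}")
  case True
  then show ?thesis using assms by (simp add: is_tri_rv_def)
next
  case False
  interpret prob_space M using assms by (simp add: is_tri_rv_def)
  have X [measurable]: "X \<in> measurable M (count_space UNIV)"
    using assms by (simp add: is_tri_rv_def)
  let ?E = "\<lambda>k. {\<omega> \<in> space M. X \<omega> = k}"
  have "prob (\<Union>k\<in>{0..int n}. ?E k) = (\<Sum>k\<in>{0..int n}. prob (?E k))"
    by (rule finite_measure_finite_Union) (auto simp: disjoint_family_on_def)
  also have "\<dots> = 1"
    using assms by (simp add: is_tri_rv_def flip: sum_divide_distrib)
  finally have 1: "prob (\<Union>k\<in>{0..int n}. ?E k) = 1" .
  have "prob (?E k \<union> (\<Union>k\<in>{0..int n}. ?E k)) = prob (?E k) + prob (\<Union>k\<in>{0..int n}. ?E k)"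
    using False by (intro finite_measure_Union) auto
  then have "prob (?E k) \<le> 0"
    using 1 prob_le_1[of "?E k \<union> (\<Union>k\<in>{0..int n}. ?E k)"] by simp
  then have "prob (?E k) = 0"
    by (simp add: measure_le_0_iff)
  moreover have "tri_num a b c a' b' c' n k = 0"
    using False by (intro tri_num_eq_0) auto
  ultimately show ?thesis by simp
qed

text \<open>Allows any realisation to be replaced by a convenient one: a \<open>pmf\<close> from the
  existence lemma, or the binomial law.\<close>

lemma is_tri_rv_distr_unique:
  assumes X: "is_tri_rv a b c a' b' c' n M X" and Y: "is_tri_rv a b c a' b' c' n N Y"
    and S: "(\<Sum>j\<in>{0..int n}. tri_num a b c a' b' c' n j) \<noteq> 0"
  shows "distr M (count_space UNIV) X = distr N (count_space UNIV) Y"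
proof (rule measure_eqI_countable[where A = UNIV])
  interpret M: prob_space M using X by (simp add: is_tri_rv_def)
  interpret N: prob_space N using Y by (simp add: is_tri_rv_def)
  have [measurable]: "X \<in> measurable M (count_space UNIV)" "Y \<in> measurable N (count_space UNIV)"
    using X Y by (auto simp: is_tri_rv_def)
  fix k :: int
  have "X -` {k} \<inter> space M = {\<omega> \<in> space M. X \<omega> = k}" "Y -` {k} \<inter> space N = {\<omega> \<in> space N. Y \<omega> = k}"
    by auto
  then show "emeasure (distr M (count_space UNIV) X) {k} = emeasure (distr N (count_space UNIV) Y) {k}"
    using is_tri_rv_prob[OF X S, of k] is_tri_rv_prob[OF Y S, of k]
    by (simp add: emeasure_distr M.emeasure_eq_measure N.emeasure_eq_measure)
qed auto

text \<open>Passing to a \<open>pmf\<close> with the same law makes the expectation a finite sum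
  over its support. The Banach codomain admits the complex exponential.\<close>

lemma is_tri_rv_integral:
  fixes f :: "int \<Rightarrow> 'b :: {banach, second_countable_topology}"
  assumes X: "is_tri_rv a 0 c 0 0 c' n M X"
    and nonneg: "a \<ge> 0" "c \<ge> 0" "c' \<ge> 0" "\<not> (a = 0 \<and> c = 0 \<and> c' = 0)"
  shows "(LINT \<omega>|M. f (X \<omega>)) =
    (\<Sum>k\<le>n. (tri_num a 0 c 0 0 c' n (int k) / (\<Prod>j=1..n. a * real j + c + c')) *\<^sub>R f (int k))"
proof -
  let ?T = "tri_num a 0 c 0 0 c' n" and ?S = "\<Prod>j=1..n. a * real j + c + c'"
  obtain p :: "int pmf" where p: "is_tri_rv a 0 c 0 0 c' n (measure_pmf p) (\<lambda>k. k)"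
    using is_tri_rv_exists[OF nonneg] by blast
  have S: "(\<Sum>j\<in>{0..int n}. ?T j) \<noteq> 0"
    using tri_num_sum_pos[OF nonneg] by (metis less_irrefl)
  have pmf: "pmf p k = ?T k / ?S" for k
    using is_tri_rv_prob[OF p S, of k] by (simp add: sum_tri_num measure_pmf_single)
  have [measurable]: "X \<in> measurable M (count_space UNIV)"
    using X by (simp add: is_tri_rv_def)
  have "(LINT \<omega>|M. f (X \<omega>)) = (LINT k|distr M (count_space UNIV) X. f k)"
    by (simp add: integral_distr)
  also have "\<dots> = (LINT k|distr (measure_pmf p) (count_space UNIV) (\<lambda>k. k). f k)"
    by (simp only: is_tri_rv_distr_unique[OF X p S])
  also have "\<dots> = (LINT k|p. f k)"
    by (simp add: integral_distr)
  also have "\<dots> = (\<Sum>k\<in>{0..int n}. pmf p k *\<^sub>R f k)"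
  proof (rule integral_measure_pmf)
    fix k assume "k \<in> set_pmf p"
    then have "pmf p k \<noteq> 0" by (simp add: set_pmf_iff)
    then show "k \<in> {0..int n}"
      using pmf[of k] by (auto intro: ccontr simp: tri_num_eq_0)
  qed simp
  finally show ?thesis
    by (simp add: pmf sum_int_atLeast0AtMost)
qed

section \<open>The binomial and the degenerate case\<close>

lemma tri_num_binomial:
  "k \<le> n \<Longrightarrow> tri_num 0 0 c 0 0 c' n (int k) = real (n choose k) * c ^ (n - k) * c' ^ k"
proof (induction n arbitrary: k)
  case (Suc n)
  show ?case
  proof (cases k)
    case 0
    then show ?thesis using Suc.IH[of 0] by (simp add: tri_num_eq_0)
  next
    case (Suc m)
    have m: "tri_num 0 0 c 0 0 c' n (int m) = real (n choose m) * c ^ (n - m) * c' ^ m"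
      using Suc.prems Suc by (intro Suc.IH) simp
    \<comment> \<open>Pascal's rule. Splitting a factor \<open>c\<close> off
      \<open>c ^ (n - m)\<close> needs \<open>m < n\<close> because subtraction is truncated; for
      \<open>m = n\<close> the column \<open>Suc m\<close> lies outside row
      \<open>n\<close>.\<close>
    show ?thesis
    proof (cases "Suc m \<le> n")
      case True
      then have "tri_num 0 0 c 0 0 c' n (int k) = real (n choose Suc m) * c ^ (n - Suc m) * c' ^ Suc m"
        using Suc Suc.IH by blast
      moreover have "c ^ (n - m) = c * c ^ (n - Suc m)"
        using True by (metis Suc_diff_Suc Suc_le_lessD power_Suc)
      ultimately show ?thesis
        using m Suc by (simp add: algebra_simps)
    next
      case False
      then have "m = n" using Suc.prems Suc by simp
      then show ?thesis using m Suc by (simp add: tri_num_eq_0)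
    qed
  qed
qed simp

text \<open>With \<open>a = 0\<close> every factor of the normaliser equals \<open>c + c'\<close>;
  splitting its exponent as \<open>m + (n - m)\<close> turns the entry into a binomial mass.\<close>

lemma is_tri_rv_binomial:
  assumes "c \<ge> 0" "c' > 0"
  shows "is_tri_rv 0 0 c 0 0 c' n (measure_pmf (map_pmf int (binomial_pmf n (c' / (c + c'))))) (\<lambda>k. k)"
  unfolding is_tri_rv_def
proof (intro conjI ballI)
  fix k assume "k \<in> {0..int n}"
  then obtain m where k: "k = int m" and m: "m \<le> n"
    by (metis atLeastAtMost_iff nonneg_int_cases of_nat_le_iff)
  let ?p = "c' / (c + c')"
  have p: "0 \<le> ?p" "?p \<le> 1" "1 - ?p = c / (c + c')"
    using assms by (auto simp: field_simps)
  have "(c + c') ^ n = (c + c') ^ m * (c + c') ^ (n - m)"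
    using m by (simp flip: power_add)
  then have "tri_num 0 0 c 0 0 c' n k / (c + c') ^ n = real (n choose m) * ?p ^ m * (1 - ?p) ^ (n - m)"
    using m by (simp add: k p tri_num_binomial power_divide)
  also have "\<dots> = pmf (map_pmf int (binomial_pmf n ?p)) k"
    using p by (simp add: k pmf_map_inj')
  finally show "measure (measure_pmf (map_pmf int (binomial_pmf n ?p)))
      {\<omega> \<in> space (measure_pmf (map_pmf int (binomial_pmf n ?p))). \<omega> = k}
    = tri_num 0 0 c 0 0 c' n k / (\<Sum>j\<in>{0..int n}. tri_num 0 0 c 0 0 c' n j)"
    by (simp add: sum_tri_num measure_pmf_single)
qed (auto simp: prob_space_measure_pmf)

text \<open>The diagonal coefficient is 0, so nothing ever leaves column 0.\<close>

lemma tri_num_zero_right: "k \<noteq> 0 \<Longrightarrow> tri_num a b c 0 0 0 n k = 0"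
  by (induction n arbitrary: k) auto

section \<open>The normal limit\<close>

lemma norm_exp_minus_1_minus_le:
  fixes s p :: real
  assumes "0 \<le> p" "p \<le> 1"
  shows "norm (1 + of_real p * (iexp s - 1) - exp (of_real p * (iexp s - 1))) \<le> exp 2 * (s\<^sup>2 * p\<^sup>2)"
proof -
  let ?w = "iexp s - 1"
  have w: "norm ?w \<le> \<bar>s\<bar>"
    using iexp_approx1[of s 0] by simp
  \<comment> \<open>Source of the constant \<open>exp 2\<close>: the Taylor remainder of
    \<open>exp z\<close> at \<open>z = p * w\<close> carries the factor \<open>exp |Re z|\<close>,
    and \<open>|Re z|\<close> is at most 2.\<close>
  have "\<bar>cos s - 1\<bar> \<le> 2"
    using cos_le_one[of s] cos_ge_minus_one[of s] by linarith
  then have "\<bar>p * (cos s - 1)\<bar> \<le> 1 * 2"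
    unfolding abs_mult using assms by (intro mult_mono) auto
  then have re: "\<bar>Re (of_real p * ?w)\<bar> \<le> 2"
    by (simp add: Re_exp)
  have "norm (exp (of_real p * ?w) - (1 + of_real p * ?w))
      \<le> exp \<bar>Re (of_real p * ?w)\<bar> * norm (of_real p * ?w) ^ 2"
    using Taylor_exp[of "of_real p * ?w" 1] by (simp add: numeral_2_eq_2)
  also have "\<dots> \<le> exp 2 * (s\<^sup>2 * p\<^sup>2)"
  proof (intro mult_mono)
    have "norm (of_real p * ?w) \<le> p * \<bar>s\<bar>"
      using assms w by (simp add: norm_mult mult_left_mono)
    then have "norm (of_real p * ?w) ^ 2 \<le> (p * \<bar>s\<bar>) ^ 2"
      by (intro power_mono) auto
    then show "norm (of_real p * ?w) ^ 2 \<le> s\<^sup>2 * p\<^sup>2"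
      by (simp add: power_mult_distrib mult.commute)
  qed (use re in auto)
  finally show ?thesis
    by (simp add: norm_minus_commute)
qed

text \<open>Puts the Poisson factors in the closed unit disc, as the product estimate below
  requires: the real part is \<open>p * (cos s - 1)\<close>.\<close>

lemma Re_iexp_minus_1_le: "0 \<le> p \<Longrightarrow> Re (of_real p * (iexp s - 1)) \<le> 0"
  by (simp add: Re_exp mult_nonneg_nonpos)

text \<open>A convex combination of \<open>1\<close> and \<open>iexp s\<close>, both of modulus
  1.\<close>

lemma norm_1_plus_iexp_minus_1_le:
  assumes "0 \<le> p" "p \<le> 1"
  shows "norm (1 + of_real p * (iexp s - 1)) \<le> 1"
proof -
  have "1 + of_real p * (iexp s - 1) = of_real (1 - p) + of_real p * iexp s"
    by (simp add: algebra_simps)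
  also have "norm \<dots> \<le> norm (of_real (1 - p) :: complex) + norm (of_real p * iexp s)"
    by (rule norm_triangle_ineq)
  also have "\<dots> = 1"
    using assms by (simp add: norm_mult del: of_real_diff)
  finally show ?thesis .
qed

text \<open>Compares a sum of independent Bernoulli variables with a Poisson variable of the same
  mean. As all factors lie in the unit disc, the error of the product is at most the sum of the
  errors of the factors. For infinite \<open>I\<close> both terms default to 1.\<close>

lemma norm_prod_bernoulli_char_le:
  fixes p :: "'i \<Rightarrow> real"
  assumes p: "\<And>j. j \<in> I \<Longrightarrow> 0 \<le> p j" "\<And>j. j \<in> I \<Longrightarrow> p j \<le> 1"
  shows "norm ((\<Prod>j\<in>I. 1 + of_real (p j) * (iexp s - 1)) - exp (of_real (\<Sum>j\<in>I. p j) * (iexp s - 1)))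
    \<le> exp 2 * (s\<^sup>2 * (\<Sum>j\<in>I. (p j)\<^sup>2))"
proof (cases "finite I")
  case True
  have "exp (of_real (\<Sum>j\<in>I. p j) * (iexp s - 1)) = (\<Prod>j\<in>I. exp (of_real (p j) * (iexp s - 1)))"
    using True by (simp add: sum_distrib_right exp_sum)
  then have "norm ((\<Prod>j\<in>I. 1 + of_real (p j) * (iexp s - 1)) - exp (of_real (\<Sum>j\<in>I. p j) * (iexp s - 1)))
    \<le> (\<Sum>j\<in>I. norm (1 + of_real (p j) * (iexp s - 1) - exp (of_real (p j) * (iexp s - 1))))"
    using p Re_iexp_minus_1_le
    by (auto intro!: norm_prod_diff norm_1_plus_iexp_minus_1_le simp only: norm_exp_eq_Re exp_le_one_iff)
  also have "\<dots> \<le> (\<Sum>j\<in>I. exp 2 * (s\<^sup>2 * (p j)\<^sup>2))"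
    using p by (intro sum_mono norm_exp_minus_1_minus_le)
  finally show ?thesis
    by (simp add: sum_distrib_left)
qed simp

text \<open>\<open>L\<close> is a convenient substitute for the mean: \<open>C\<close> bounds the
  discrepancy, while \<open>D\<close> keeps the Poisson error of order
  \<open>1 / L n\<close>.\<close>

lemma bernoulli_char_tendsto_normal:
  fixes p L :: "nat \<Rightarrow> real"
  assumes p: "\<And>j. j \<ge> 1 \<Longrightarrow> 0 \<le> p j" "\<And>j. j \<ge> 1 \<Longrightarrow> p j \<le> 1"
    and L: "filterlim L at_top sequentially"
    and C: "\<And>n. \<bar>(\<Sum>j=1..n. p j) - L n\<bar> \<le> C"
    and D: "\<And>n. (\<Sum>j=1..n. (p j)\<^sup>2) \<le> D"
  shows "(\<lambda>n. iexp (- t * sqrt (L n)) * (\<Prod>j=1..n. 1 + of_real (p j) * (iexp (t / sqrt (L n)) - 1)))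
    \<longlonglongrightarrow> of_real (exp (- (t\<^sup>2) / 2))"
proof -
  define \<sigma> where "\<sigma> = (\<lambda>n. sqrt (L n))"
  define w where "w = (\<lambda>n. iexp (t / \<sigma> n) - 1)"
  define S where "S = (\<lambda>n. \<Sum>j=1..n. p j)"
  define P where "P = (\<lambda>n. \<Prod>j=1..n. 1 + of_real (p j) * w n)"
  have \<sigma>: "filterlim \<sigma> at_top sequentially"
    unfolding \<sigma>_def by (rule filterlim_compose[OF sqrt_at_top L])
  then have div: "(\<lambda>n. K / \<sigma> n) \<longlonglongrightarrow> 0" for K
    by (intro tendsto_divide_0[OF tendsto_const] filterlim_at_top_imp_at_infinity)
  \<comment> \<open>Positivity is known only eventually; it gives
    \<open>L n = \<sigma> n ^ 2\<close> and permits division by \<open>\<sigma> n\<close>.\<close>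
  have ev: "eventually (\<lambda>n. \<sigma> n > 0) sequentially"
    using \<sigma> by (simp add: filterlim_at_top_dense)
  \<comment> \<open>Poisson replacement: the centring factor has modulus 1, so it does not enlarge
    the error.\<close>
  have "(\<lambda>n. iexp (- t * \<sigma> n) * (P n - exp (of_real (S n) * w n))) \<longlonglongrightarrow> 0"
  proof (rule Lim_null_comparison)
    have "norm (iexp (- t * \<sigma> n) * (P n - exp (of_real (S n) * w n))) \<le> exp 2 * ((t / \<sigma> n)\<^sup>2 * D)" for n
    proof -
      have "norm (iexp (- t * \<sigma> n) * (P n - exp (of_real (S n) * w n)))
        = norm (P n - exp (of_real (S n) * w n))"
        unfolding norm_mult norm_exp_i_times by simp
      also have "\<dots> \<le> exp 2 * ((t / \<sigma> n)\<^sup>2 * (\<Sum>j=1..n. (p j)\<^sup>2))"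
        unfolding P_def S_def w_def by (rule norm_prod_bernoulli_char_le) (use p in auto)
      also have "\<dots> \<le> exp 2 * ((t / \<sigma> n)\<^sup>2 * D)"
        by (intro mult_left_mono D) auto
      finally show ?thesis .
    qed
    then show "\<forall>\<^sub>F n in sequentially. norm (iexp (- t * \<sigma> n) * (P n - exp (of_real (S n) * w n)))
      \<le> exp 2 * ((t / \<sigma> n)\<^sup>2 * D)"
      by simp
    show "(\<lambda>n. exp 2 * ((t / \<sigma> n)\<^sup>2 * D)) \<longlonglongrightarrow> 0"
      by (intro tendsto_mult_right_zero tendsto_mult_left_zero tendsto_null_power div) simp
  qed
  moreover have "(\<lambda>n. iexp (- t * \<sigma> n) * exp (of_real (S n) * w n)) \<longlonglongrightarrow> exp (of_real (- (t\<^sup>2) / 2))"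
  proof -
    let ?E = "\<lambda>n. \<i> * of_real (- t * \<sigma> n) + of_real (S n) * w n"
    have "(\<lambda>n. ?E n - of_real (- (t\<^sup>2) / 2)) \<longlonglongrightarrow> 0"
    proof (rule Lim_null_comparison)
      show "\<forall>\<^sub>F n in sequentially. norm (?E n - of_real (- (t\<^sup>2) / 2)) \<le> C * \<bar>t\<bar> / \<sigma> n + \<bar>t\<bar> ^ 3 / 6 / \<sigma> n"
        using ev
      proof eventually_elim
        case (elim n)
        have L_eq: "L n = \<sigma> n ^ 2"
          using elim by (simp add: \<sigma>_def)
        define s where "s = t / \<sigma> n"
        have t: "t = s * \<sigma> n"
          using elim by (simp add: s_def)
        let ?R = "iexp s - (\<Sum>k\<le>2. (\<i> * of_real s) ^ k / fact k)"
        \<comment> \<open>In the second order expansion of \<open>L n * (iexp s - 1)\<close> the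
          linear term cancels the centring and the quadratic term is \<open>- t^2 / 2\<close>. What
          remains is the error of the mean and the Taylor remainder, both of order
          \<open>1 / \<sigma> n\<close>.\<close>
        have "?E n - of_real (- (t\<^sup>2) / 2) = of_real (S n - L n) * w n + of_real (L n) * ?R"
          unfolding w_def L_eq s_def[symmetric] t
          by (simp add: numeral_2_eq_2 algebra_simps)
        also have "norm \<dots> \<le> norm (of_real (S n - L n) * w n) + norm (of_real (L n) * ?R)"
          by (rule norm_triangle_ineq)
        also have "\<dots> \<le> C * \<bar>s\<bar> + \<sigma> n ^ 2 * (\<bar>s\<bar> ^ 3 / 6)"
        proof (rule add_mono)
          have "norm (w n) \<le> \<bar>s\<bar>"
            using iexp_approx1[of s 0] by (simp add: w_def s_def)
          moreover have "norm (of_real (S n - L n) :: complex) \<le> C"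
            using C[of n] unfolding norm_of_real S_def .
          ultimately show "norm (of_real (S n - L n) * w n) \<le> C * \<bar>s\<bar>"
            unfolding norm_mult by (intro mult_mono) (auto intro: order_trans[OF norm_ge_zero])
          have "norm ?R \<le> \<bar>s\<bar> ^ 3 / 6"
            using iexp_approx1[of s 2] by (simp add: eval_nat_numeral)
          then show "norm (of_real (L n) * ?R) \<le> \<sigma> n ^ 2 * (\<bar>s\<bar> ^ 3 / 6)"
            unfolding norm_mult L_eq by (intro mult_mono) (auto simp: norm_power)
        qed
        also have "\<dots> = C * \<bar>t\<bar> / \<sigma> n + \<bar>t\<bar> ^ 3 / 6 / \<sigma> n"
          using elim by (simp add: s_def field_simps power2_eq_square power3_eq_cube)
        finally show ?case .
      qed
      show "(\<lambda>n. C * \<bar>t\<bar> / \<sigma> n + \<bar>t\<bar> ^ 3 / 6 / \<sigma> n) \<longlonglongrightarrow> 0"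
        by (intro tendsto_add_zero div)
    qed
    then have "?E \<longlonglongrightarrow> of_real (- (t\<^sup>2) / 2)"
      by (rule LIM_zero_cancel)
    then have "(\<lambda>n. exp (?E n)) \<longlonglongrightarrow> exp (of_real (- (t\<^sup>2) / 2))"
      by (rule tendsto_exp)
    then show ?thesis
      by (simp only: exp_add)
  qed
  ultimately have "(\<lambda>n. iexp (- t * \<sigma> n) * P n) \<longlonglongrightarrow> 0 + exp (of_real (- (t\<^sup>2) / 2))"
    by (auto dest: tendsto_add simp: algebra_simps)
  then show ?thesis
    unfolding P_def w_def \<sigma>_def by (simp only: exp_of_real add_0)
qed

section \<open>Sums of \<open>1 / j^2\<close> and of \<open>1 / (j + d)\<close>\<close>

lemma sum_inverse_squares_le: "(\<Sum>j=1..n. 1 / (real j)\<^sup>2) \<le> (\<Sum>j. 1 / (real j)\<^sup>2)"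
proof (rule sum_le_suminf)
  \<comment> \<open>The series includes \<open>j = 0\<close>, where
    \<open>1 / 0 = 0\<close>.\<close>
  show "summable (\<lambda>j. 1 / (real j)\<^sup>2)"
    using inverse_power_summable[of 2, where 'a = real] by (simp add: inverse_eq_divide)
qed auto

text \<open>\<open>harm n - ln n\<close> converges to Euler's constant, and shifting by
  \<open>d\<close> changes the \<open>j\<close>-th term by at most \<open>d / j^2\<close>, which is
  summable. The bound covers \<open>n = 0\<close>, where \<open>ln 0 = 0\<close>.\<close>

lemma sum_inverse_shift_minus_ln_bounded:
  fixes d :: real
  assumes "d \<ge> 0"
  obtains C where "\<And>n. \<bar>(\<Sum>j=1..n. 1 / (real j + d)) - ln (real n)\<bar> \<le> C"
proof -
  have "Bseq (\<lambda>n. harm n - ln (real n))"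
    using euler_mascheroni_convergent by (rule convergent_imp_Bseq)
  then obtain K where K: "\<And>n. \<bar>harm n - ln (real n)\<bar> \<le> K"
    by (auto simp: Bseq_def)
  show thesis
  proof
    fix n
    have eq: "1 / real j - 1 / (real j + d) = d / (real j * (real j + d))" if "j \<ge> 1" for j
      using assms that by (simp add: field_simps)
    have "harm n - (\<Sum>j=1..n. 1 / (real j + d)) = (\<Sum>j=1..n. d / (real j * (real j + d)))"
      unfolding harm_def inverse_eq_divide sum_subtractf[symmetric]
      by (intro sum.cong refl eq) simp
    moreover have "\<dots> \<le> (\<Sum>j=1..n. d * (1 / (real j)\<^sup>2))"
    proof (rule sum_mono)
      fix j assume "j \<in> {1..n}"
      then show "d / (real j * (real j + d)) \<le> d * (1 / (real j)\<^sup>2)"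
        using assms by (auto simp: power2_eq_square intro!: divide_left_mono)
    qed
    moreover have "\<dots> \<le> d * (\<Sum>j. 1 / (real j)\<^sup>2)"
      using assms by (simp only: sum_distrib_left[symmetric] mult_left_mono sum_inverse_squares_le)
    moreover have "0 \<le> (\<Sum>j=1..n. d / (real j * (real j + d)))"
      using assms by (intro sum_nonneg) auto
    ultimately show "\<bar>(\<Sum>j=1..n. 1 / (real j + d)) - ln (real n)\<bar> \<le> K + d * (\<Sum>j. 1 / (real j)\<^sup>2)"
      using K[of n] by linarith
  qed
qed

text \<open>The generating function at \<open>iexp (t / s)\<close>, divided factor by factor by its
  value at 1, yields the Bernoulli factors. For \<open>s = 0\<close> both sides are 1, which covers
  rows 0 and 1, where \<open>ln n = 0\<close>.\<close>

lemma is_tri_rv_char: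
  assumes X: "is_tri_rv a 0 c 0 0 c' n M X"
    and nonneg: "a \<ge> 0" "c \<ge> 0" "c' > 0"
  shows "char (distr M borel (\<lambda>\<omega>. (real_of_int (X \<omega>) - m) / s)) t =
    iexp (- t * (m / s)) * (\<Prod>j=1..n. 1 + of_real (c' / (a * real j + c + c')) * (iexp (t / s) - 1))"
proof -
  let ?S = "\<Prod>j=1..n. a * real j + c + c'"
  let ?T = "\<lambda>k. tri_num a 0 c 0 0 c' n (int k)"
  have pos: "a * real j + c + c' > 0" for j
    using nonneg by (simp add: add_nonneg_pos)
  have [measurable]: "X \<in> measurable M (count_space UNIV)"
    using X by (simp add: is_tri_rv_def)
  have "char (distr M borel (\<lambda>\<omega>. (real_of_int (X \<omega>) - m) / s)) t
    = (LINT \<omega>|M. (\<lambda>k. iexp (t * ((real_of_int k - m) / s))) (X \<omega>))"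
    unfolding char_def by (subst integral_distr) auto
  also have "\<dots> = (\<Sum>k\<le>n. (?T k / ?S) *\<^sub>R iexp (t * ((real_of_int (int k) - m) / s)))"
    by (rule is_tri_rv_integral[OF X]) (use nonneg in auto)
  also have "\<dots> = iexp (- t * (m / s)) / of_real ?S * (\<Sum>k\<le>n. of_real (?T k) * iexp (t / s) ^ k)"
    unfolding sum_distrib_left
  proof (intro sum.cong refl)
    fix k
    \<comment> \<open>The exponent is affine in \<open>k\<close>: the constant part is the centring,
      the rest gives the \<open>k\<close>-th power of \<open>iexp (t / s)\<close>.\<close>
    have "\<i> * of_real (t * ((real_of_int (int k) - m) / s)) = \<i> * of_real (- t * (m / s)) + of_nat k * (\<i> * of_real (t / s))"
      by (simp add: algebra_simps diff_divide_distrib)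
    then show "(?T k / ?S) *\<^sub>R iexp (t * ((real_of_int (int k) - m) / s))
      = iexp (- t * (m / s)) / of_real ?S * (of_real (?T k) * iexp (t / s) ^ k)"
      by (simp only: exp_add exp_of_nat_mult) (simp add: scaleR_conv_of_real)
  qed
  also have "\<dots> = iexp (- t * (m / s)) *
    ((\<Prod>j=1..n. of_real (a * real j + c) + of_real c' * iexp (t / s)) / (\<Prod>j=1..n. of_real (a * real j + c + c')))"
    by (simp only: sum_tri_num_power of_real_prod) simp
  also have "(\<Prod>j=1..n. of_real (a * real j + c) + of_real c' * iexp (t / s)) / (\<Prod>j=1..n. of_real (a * real j + c + c'))
    = (\<Prod>j=1..n. 1 + of_real (c' / (a * real j + c + c')) * (iexp (t / s) - 1))"
    unfolding prod_dividef[symmetric]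
  proof (intro prod.cong refl)
    fix j
    have "(of_real (a * real j + c + c') :: complex) \<noteq> 0"
      using pos[of j] by (simp only: of_real_eq_0_iff)
    then show "(of_real (a * real j + c) + of_real c' * iexp (t / s)) / of_real (a * real j + c + c')
      = 1 + of_real (c' / (a * real j + c + c')) * (iexp (t / s) - 1)"
      unfolding of_real_divide by (simp add: field_simps)
  qed
  finally show ?thesis .
qed

lemma is_tri_rv_weak_conv_normal:
  fixes M :: "nat \<Rightarrow> 'a measure"
  assumes X: "\<And>n. is_tri_rv a 0 c 0 0 c' n (M n) (X n)"
    and nonneg: "a > 0" "c \<ge> 0" "c' > 0"
  shows "weak_conv_m
    (\<lambda>n. distr (M n) borel (\<lambda>\<omega>. (real_of_int (X n \<omega>) - c' / a * ln (real n)) / sqrt (c' / a * ln (real n))))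
    std_normal_distribution"
proof (rule levy_continuity)
  fix n
  interpret prob_space "M n" using X[of n] by (simp add: is_tri_rv_def)
  have [measurable]: "X n \<in> measurable (M n) (count_space UNIV)"
    using X[of n] by (simp add: is_tri_rv_def)
  show "real_distribution (distr (M n) borel
      (\<lambda>\<omega>. (real_of_int (X n \<omega>) - c' / a * ln (real n)) / sqrt (c' / a * ln (real n))))"
    by (rule real_distribution_distr) simp
next
  show "real_distribution std_normal_distribution"
    by (rule real_dist_normal_dist)
next
  fix t
  \<comment> \<open>Dividing by \<open>a\<close> brings the Bernoulli parameters into the form
    \<open>\<rho> / (j + d)\<close> of the shifted harmonic sum.\<close>
  define \<rho> d where "\<rho> = c' / a" and "d = (c + c') / a"
  define p where "p = (\<lambda>j::nat. c' / (a * real j + c + c'))"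
  define L where "L = (\<lambda>n::nat. \<rho> * ln (real n))"
  have \<rho>: "\<rho> > 0" and d: "d \<ge> 0"
    using nonneg by (auto simp: \<rho>_def d_def)
  have p_eq: "p j = \<rho> * (1 / (real j + d))" for j
    using nonneg by (simp add: p_def \<rho>_def d_def field_simps)
  obtain C where C: "\<And>n. \<bar>(\<Sum>j=1..n. 1 / (real j + d)) - ln (real n)\<bar> \<le> C"
    using sum_inverse_shift_minus_ln_bounded[OF d] by blast
  have conv: "(\<lambda>n. iexp (- t * sqrt (L n)) * (\<Prod>j=1..n. 1 + of_real (p j) * (iexp (t / sqrt (L n)) - 1)))
    \<longlonglongrightarrow> of_real (exp (- (t\<^sup>2) / 2))"
  proof (rule bernoulli_char_tendsto_normal)
    fix j :: nat
    have "a * real j + c \<ge> 0" using nonneg by simp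
    then show "0 \<le> p j" "p j \<le> 1"
      using nonneg by (auto simp: p_def divide_le_eq_1)
  next
    show "filterlim L at_top sequentially"
      unfolding L_def
      by (intro filterlim_tendsto_pos_mult_at_top[OF tendsto_const \<rho>]
          filterlim_compose[OF ln_at_top] filterlim_real_sequentially)
  next
    fix n
    have "(\<Sum>j=1..n. p j) - L n = \<rho> * ((\<Sum>j=1..n. 1 / (real j + d)) - ln (real n))"
      by (simp only: p_eq L_def sum_distrib_left right_diff_distrib)
    then show "\<bar>(\<Sum>j=1..n. p j) - L n\<bar> \<le> \<rho> * C"
      using C[of n] \<rho> by (simp add: abs_mult)
  next
    fix n
    have "(\<Sum>j=1..n. (p j)\<^sup>2) \<le> (\<Sum>j=1..n. \<rho>\<^sup>2 * (1 / (real j)\<^sup>2))"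
    proof (rule sum_mono)
      fix j assume "j \<in> {1..n}"
      then have "1 / (real j + d) \<le> 1 / real j" "0 \<le> 1 / (real j + d)"
        using d by (auto intro!: divide_left_mono)
      then have "(1 / (real j + d))\<^sup>2 \<le> (1 / real j)\<^sup>2"
        by (intro power_mono)
      then show "(p j)\<^sup>2 \<le> \<rho>\<^sup>2 * (1 / (real j)\<^sup>2)"
        unfolding p_eq power_mult_distrib by (intro mult_left_mono) (auto simp: power_divide)
    qed
    also have "\<dots> \<le> \<rho>\<^sup>2 * (\<Sum>j. 1 / (real j)\<^sup>2)"
      by (simp only: sum_distrib_left[symmetric] mult_left_mono sum_inverse_squares_le zero_le_power2)
    finally show "(\<Sum>j=1..n. (p j)\<^sup>2) \<le> \<rho>\<^sup>2 * (\<Sum>j. 1 / (real j)\<^sup>2)" .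
  qed
  have "char (distr (M n) borel
      (\<lambda>\<omega>. (real_of_int (X n \<omega>) - c' / a * ln (real n)) / sqrt (c' / a * ln (real n)))) t
    = iexp (- t * sqrt (L n)) * (\<Prod>j=1..n. 1 + of_real (p j) * (iexp (t / sqrt (L n)) - 1))" for n
  proof -
    \<comment> \<open>Centring over scale is \<open>sqrt (L n)\<close>, even in rows 0 and 1: there
      \<open>L n = 0\<close> and \<open>0 / sqrt 0 = 0\<close>.\<close>
    have "L n \<ge> 0" 
      using \<rho> by (cases "n = 0") (auto simp: L_def)
    then have "L n / sqrt (L n) = sqrt (L n)"
      by (rule real_div_sqrt)
    then show ?thesis
      using is_tri_rv_char[OF X[of n], of "L n" "sqrt (L n)" t] nonneg
      by (simp add: L_def \<rho>_def p_def)
  qed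
  then show "(\<lambda>n. char (distr (M n) borel
      (\<lambda>\<omega>. (real_of_int (X n \<omega>) - c' / a * ln (real n)) / sqrt (c' / a * ln (real n)))) t)
    \<longlonglongrightarrow> char std_normal_distribution t"
    using conv by (simp only: char_std_normal_distribution)
qed

theorem theorem4:
  fixes \<alpha> \<gamma> \<gamma>' :: real
    and M :: "nat \<Rightarrow> 'a measure" and X :: "nat \<Rightarrow> 'a \<Rightarrow> int"
  assumes "\<alpha> \<ge> 0" "\<gamma> \<ge> 0" "\<gamma>' \<ge> 0" "\<not> (\<alpha> = 0 \<and> \<gamma> = 0 \<and> \<gamma>' = 0)"
    and "\<And>n. is_tri_rv \<alpha> 0 \<gamma> 0 0 \<gamma>' n (M n) (X n)"
  shows
    "(\<gamma>' > 0 \<and> \<alpha> > 0 \<longrightarrow>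
        weak_conv_m
          (\<lambda>n. distr (M n) borel
             (\<lambda>\<omega>. (real_of_int (X n \<omega>) - \<gamma>' / \<alpha> * ln (real n)) / sqrt (\<gamma>' / \<alpha> * ln (real n))))
          std_normal_distribution)
   \<and> (\<gamma>' > 0 \<and> \<alpha> = 0 \<longrightarrow>
        (\<forall>n. distr (M n) (count_space UNIV) (X n) =
             measure_pmf (map_pmf int (binomial_pmf n (\<gamma>' / (\<gamma> + \<gamma>'))))))
   \<and> (\<gamma>' = 0 \<longrightarrow> (\<forall>n. AE \<omega> in M n. X n \<omega> = 0))"
proof (intro conjI impI allI)
  assume "\<gamma>' > 0 \<and> \<alpha> > 0"
  then show "weak_conv_m
      (\<lambda>n. distr (M n) borel
         (\<lambda>\<omega>. (real_of_int (X n \<omega>) - \<gamma>' / \<alpha> * ln (real n)) / sqrt (\<gamma>' / \<alpha> * ln (real n))))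
      std_normal_distribution"
    using assms by (intro is_tri_rv_weak_conv_normal) auto
next
  fix n
  have S: "(\<Sum>j\<in>{0..int n}. tri_num \<alpha> 0 \<gamma> 0 0 \<gamma>' n j) \<noteq> 0"
    using tri_num_sum_pos[OF assms(1-4)] by (metis less_irrefl)
  {
    assume *: "\<gamma>' > 0 \<and> \<alpha> = 0"
    \<comment> \<open>By uniqueness it suffices that the binomial law obeys the same
      specification.\<close>
    then have "is_tri_rv \<alpha> 0 \<gamma> 0 0 \<gamma>' n (measure_pmf (map_pmf int (binomial_pmf n (\<gamma>' / (\<gamma> + \<gamma>'))))) (\<lambda>k. k)"
      using is_tri_rv_binomial assms(2) by simp
    from is_tri_rv_distr_unique[OF assms(5) this S]
    show "distr (M n) (count_space UNIV) (X n) =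
        measure_pmf (map_pmf int (binomial_pmf n (\<gamma>' / (\<gamma> + \<gamma>'))))"
      by (simp add: distr_id2)
  }
  assume *: "\<gamma>' = 0"
  interpret prob_space "M n" using assms(5)[of n] by (simp add: is_tri_rv_def)
  have [measurable]: "X n \<in> measurable (M n) (count_space UNIV)"
    using assms(5)[of n] by (simp add: is_tri_rv_def)
  \<comment> \<open>Column 0 carries the whole row, so its mass is the normaliser divided by
    itself.\<close>
  have "(\<Sum>j\<in>{0..int n}. tri_num \<alpha> 0 \<gamma> 0 0 \<gamma>' n j) = tri_num \<alpha> 0 \<gamma> 0 0 \<gamma>' n 0"
    by (subst sum.remove[of _ 0]) (auto simp: * tri_num_zero_right)
  then have "prob {\<omega> \<in> space (M n). X n \<omega> = 0} = 1"
    using is_tri_rv_prob[OF assms(5) S, of 0] S by simp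
  then show "AE \<omega> in M n. X n \<omega> = 0"
    by (subst (asm) prob_Collect_eq_1) auto
qed

end
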